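(* Let $\mathcal{S}$ be a commutative semiring with $0$ and $1$ in which distinct formal polynomials in one variable define distinct functions $\mathcal{S}\to\mathcal{S}$. Then $UT_2(\mathcal{S})$ does not satisfy any (non-trivial) semigroup or monoid identity; hence, for every $n\ge 2$, neither $UT_n(\mathcal{S})$ nor the full matrix semigroup $M_n(\mathcal{S})$ satisfies any (non-trivial) semigroup or monoid identity.
   Context: Semirings have associative operations $+$ and $\times$, with $+$ commutative, $\times$ distributing over $+$, $0\neq 1$, $1$ a multiplicative identity, and $0$ an additive identity and multiplicative zero; commutative means multiplication is commutative. $M_n(\mathcal{S})$ is the monoid of all $n\times n$ matrices over $\mathcal{S}$ under matrix multiplication and $UT_n(\mathcal{S})$ is its submonoid of upper triangular matrices. A semigroup (resp. monoid) identity is a pair $u=v$ of words in $\Sigma^+$ (resp. $\Sigma^*$) over an alphabet $\Sigma$; it is non-trivial if $u\ne v$ as words, and it is satisfied by a semigroup (resp. monoid) $M$ if $g(u)=g(v)$ for every morphism $g$ from $\Sigma^+$ (resp. $\Sigma^*$) to $M$. *)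

theory Defs
  imports "Jordan_Normal_Form.Matrix" "HOL-Computational_Algebra.Polynomial"
begin

text \<open>Words over the alphabet \<open>'x\<close> are lists: \<open>\<Sigma>\<^sup>*\<close> is the set of all lists, \<open>\<Sigma>\<^sup>+\<close>
  the set of nonempty ones.\<close>

definition free_monoid :: "'x list monoid" where
  "free_monoid = \<lparr>carrier = UNIV, mult = (@), one = []\<rparr>"

text \<open>The \<open>one\<close> field is meaningless in the next record (the library has no record type for
  semigroups); neither \<^const>\<open>hom\<close> nor anything below looks at it.\<close>

definition free_semigroup :: "'x list monoid" where
  "free_semigroup = free_monoid\<lparr>carrier := {w. w \<noteq> []}\<rparr>"

text \<open>\<^const>\<open>hom\<close> only requires products to be preserved, so preservation of the identity is
  added for monoid morphisms.\<close>

definition monoid_morphisms ::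
    "('a, 'c) monoid_scheme \<Rightarrow> ('b, 'd) monoid_scheme \<Rightarrow> ('a \<Rightarrow> 'b) set" where
  "monoid_morphisms G H = {g \<in> hom G H. g \<one>\<^bsub>G\<^esub> = \<one>\<^bsub>H\<^esub>}"

definition satisfies_semigroup_identity ::
    "('a, 'c) monoid_scheme \<Rightarrow> 'x list \<Rightarrow> 'x list \<Rightarrow> bool" where
  "satisfies_semigroup_identity M u v \<longleftrightarrow>
     u \<in> carrier free_semigroup \<and> v \<in> carrier free_semigroup \<and>
     (\<forall>g \<in> hom free_semigroup M. g u = g v)"

definition satisfies_monoid_identity ::
    "('a, 'c) monoid_scheme \<Rightarrow> 'x list \<Rightarrow> 'x list \<Rightarrow> bool" where
  "satisfies_monoid_identity M u v \<longleftrightarrow>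
     u \<in> carrier free_monoid \<and> v \<in> carrier free_monoid \<and>
     (\<forall>g \<in> monoid_morphisms free_monoid M. g u = g v)"

definition mat_monoid :: "nat \<Rightarrow> 'a::semiring_1 mat monoid" where
  "mat_monoid n = \<lparr>carrier = carrier_mat n n, mult = (*), one = 1\<^sub>m n\<rparr>"

definition ut_monoid :: "nat \<Rightarrow> 'a::semiring_1 mat monoid" where
  "ut_monoid n = (mat_monoid n)\<lparr>carrier := {A \<in> carrier_mat n n. upper_triangular A}\<rparr>"

lemma monoid_free_monoid: "Group.monoid free_monoid"
  by (unfold_locales) (auto simp: free_monoid_def)

lemma monoid_mat_monoid: "Group.monoid (mat_monoid n)"
  by (unfold_locales) (auto simp: mat_monoid_def)

lemma upper_triangular_mult:
  fixes A B :: "'a::semiring_1 mat"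
  assumes A: "A \<in> carrier_mat n n" "upper_triangular A"
    and B: "B \<in> carrier_mat n n" "upper_triangular B"
  shows "upper_triangular (A * B)"
proof (rule upper_triangularI)
  fix i j assume ij: "j < i" "i < dim_row (A * B)"
  have "A $$ (i, k) * B $$ (k, j) = 0" if "k < n" for k
    using that ij A B upper_triangularD[OF A(2), of k i] upper_triangularD[OF B(2), of j k]
    by (cases "k < i") auto
  then show "(A * B) $$ (i, j) = 0"
    using ij A B by (auto simp: scalar_prod_def intro!: sum.neutral)
qed

lemma submonoid_ut_monoid: "submonoid (carrier (ut_monoid n)) (mat_monoid n)"
  by (unfold_locales) (auto simp: mat_monoid_def ut_monoid_def intro: upper_triangular_mult)

end

theory Submission
  imports Defs
begin

text \<open>A word is recovered from the sets of positions at which its various letters occur, so two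
  distinct words differ in the positions of some letter \<open>y\<close>. These positions are recorded by the
  polynomial \<open>\<Sum>t\<^sup>i\<close>, summed over the positions \<open>i\<close> of \<open>y\<close>, and this polynomial can be computed by
  upper triangular matrices: sending \<open>y\<close> to the \<open>2 \<times> 2\<close> matrix with rows \<open>(t, 1)\<close>, \<open>(0, 1)\<close> and
  every other letter to the one with rows \<open>(t, 0)\<close>, \<open>(0, 1)\<close> defines a morphism under which the
  polynomial appears as the upper right entry. This is the Horner scheme, read as a composition of
  affine maps \<open>X \<mapsto> t X + b\<close>.

  The two polynomials have coefficients 0 and 1, hence differ formally for distinct words as
  \<open>0 \<noteq> 1\<close>; by hypothesis some value of \<open>t\<close> in the semiring separates them. So distinct words are
  separated by a monoid morphism into upper triangular matrices. Padding with an identity block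
  carries the morphism to every size \<open>n \<ge> 2\<close>, and the full matrix monoid contains its image.\<close>

definition position_poly :: "'x \<Rightarrow> 'x list \<Rightarrow> 'a::comm_semiring_1 poly" where
  "position_poly y w = Poly (map (\<lambda>x. if x = y then 1 else 0) w)"

lemma coeff_position_poly:
  "coeff (position_poly y w) i = (if i < length w \<and> w ! i = y then 1 else 0)"
  by (simp add: position_poly_def coeff_Poly_eq nth_default_def)

lemma position_poly_Nil [simp]: "position_poly y [] = 0"
  by (simp add: position_poly_def)

lemma poly_position_poly_append:
  "poly (position_poly y (u @ v)) t =
     poly (position_poly y u) t + t ^ length u * poly (position_poly y v) t"
  by (induction u) (simp_all add: position_poly_def algebra_simps)

text \<open>A word has an \<open>i\<close>-th position exactly when some letter occurs there, so the position
  polynomials determine its length as well as its letters.\<close>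

lemma position_polys_determine_word:
  fixes u v :: "'x list"
  assumes "\<And>y. position_poly y u = (position_poly y v :: 'a::comm_semiring_1 poly)"
  shows "u = v"
proof -
  have same: "i < length u \<and> u ! i = y \<longleftrightarrow> i < length v \<and> v ! i = y" for i y
  proof -
    have "coeff (position_poly y u :: 'a poly) i = coeff (position_poly y v) i"
      using assms by simp
    then show ?thesis
      by (auto simp: coeff_position_poly split: if_splits)
  qed
  have "i < length u \<longleftrightarrow> i < length v" for i
    using same by blast
  then have "length u = length v"
    by (meson linorder_neqE_nat less_irrefl)
  with same show ?thesis
    by (intro nth_equalityI) auto
qed

text \<open>The affine map \<open>X \<mapsto> a X + b\<close>, in the upper left corner of an identity matrix.\<close>

definition affine_mat :: "nat \<Rightarrow> 'a::semiring_1 \<Rightarrow> 'a \<Rightarrow> 'a mat" where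
  "affine_mat n a b = mat n n (\<lambda>(i, j).
     if i = 0 \<and> j = 0 then a else if i = 0 \<and> j = 1 then b else if i = j then 1 else 0)"

lemma affine_mat_carrier: "affine_mat n a b \<in> carrier_mat n n"
  by (simp add: affine_mat_def)

lemma upper_triangular_affine_mat: "upper_triangular (affine_mat n a b)"
  by (auto simp: affine_mat_def)

lemma affine_mat_corner: "2 \<le> n \<Longrightarrow> affine_mat n a b $$ (0, 1) = b"
  by (simp add: affine_mat_def)

lemma affine_mat_one: "affine_mat n 1 0 = 1\<^sub>m n"
  by (rule eq_matI) (auto simp: affine_mat_def)

lemma affine_mat_mult:
  assumes "2 \<le> n"
  shows "affine_mat n a b * affine_mat n c d = affine_mat n (a * c) (a * d + b)"
proof (rule eq_matI)
  fix i j
  assume "i < dim_row (affine_mat n (a * c) (a * d + b))"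
    and "j < dim_col (affine_mat n (a * c) (a * d + b))"
  then have ij: "i < n" "j < n"
    by (simp_all add: affine_mat_def)
  let ?A = "affine_mat n a b" and ?B = "affine_mat n c d"
  have "(?A * ?B) $$ (i, j) = (\<Sum>k = 0..<n. ?A $$ (i, k) * ?B $$ (k, j))"
    using ij by (simp add: affine_mat_def scalar_prod_def)
  \<comment> \<open>Row \<open>i\<close> of the left factor is supported on the columns 0, 1 and \<open>i\<close>.\<close>
  also have "\<dots> = (\<Sum>k \<in> {0, 1, i}. ?A $$ (i, k) * ?B $$ (k, j))"
    using ij assms by (intro sum.mono_neutral_right) (auto simp: affine_mat_def)
  also have "\<dots> = affine_mat n (a * c) (a * d + b) $$ (i, j)"
    using ij assms by (cases "i = 0"; cases "i = 1") (auto simp: affine_mat_def insert_commute)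
  finally show "(?A * ?B) $$ (i, j) = affine_mat n (a * c) (a * d + b) $$ (i, j)" .
qed (simp_all add: affine_mat_def)

text \<open>The morphism that computes position polynomials is given by its value on every word; on a
  one-letter word it is the matrix of \<open>X \<mapsto> t X + 1\<close> or \<open>X \<mapsto> t X\<close>.\<close>

definition position_rep :: "nat \<Rightarrow> 'a::comm_semiring_1 \<Rightarrow> 'x \<Rightarrow> 'x list \<Rightarrow> 'a mat" where
  "position_rep n t y w = affine_mat n (t ^ length w) (poly (position_poly y w) t)"

lemma position_rep_morphism:
  assumes "2 \<le> n"
  shows "position_rep n t y \<in> monoid_morphisms free_monoid (ut_monoid n)"
  using assms
  by (auto simp: monoid_morphisms_def hom_def free_monoid_def ut_monoid_def mat_monoid_def
      position_rep_def affine_mat_carrier upper_triangular_affine_mat affine_mat_one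
      affine_mat_mult power_add poly_position_poly_append add.commute)

lemma ut_monoid_separates_words:
  fixes u v :: "'x list"
  assumes poly_inj: "\<And>p q :: 'a::comm_semiring_1 poly. p \<noteq> q \<Longrightarrow> poly p \<noteq> poly q"
    and "2 \<le> n" and "u \<noteq> v"
  shows "\<exists>g \<in> monoid_morphisms free_monoid (ut_monoid n :: 'a mat monoid). g u \<noteq> g v"
proof -
  obtain y where "position_poly y u \<noteq> (position_poly y v :: 'a poly)"
    using \<open>u \<noteq> v\<close> position_polys_determine_word[of u v] by auto
  then have "poly (position_poly y u) \<noteq> poly (position_poly y v :: 'a poly)"
    by (rule poly_inj)
  then obtain t :: 'a where "poly (position_poly y u) t \<noteq> poly (position_poly y v) t"
    by (auto simp: fun_eq_iff)
  then have "position_rep n t y u \<noteq> position_rep n t y v"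
    unfolding position_rep_def by (metis affine_mat_corner[OF \<open>2 \<le> n\<close>])
  then show ?thesis
    using position_rep_morphism[OF \<open>2 \<le> n\<close>] by (rule bexI)
qed

lemma morphism_ut_monoid_into_mat_monoid:
  assumes "g \<in> monoid_morphisms G (ut_monoid n)"
  shows "g \<in> monoid_morphisms G (mat_monoid n)"
  using assms by (auto simp: monoid_morphisms_def hom_def ut_monoid_def mat_monoid_def Pi_def)

lemma monoid_morphism_restricts_to_free_semigroup:
  assumes "g \<in> monoid_morphisms free_monoid M"
  shows "g \<in> hom free_semigroup M"
  using assms by (auto simp: monoid_morphisms_def hom_def free_semigroup_def free_monoid_def)

lemma no_identity_if_words_separated:
  fixes M :: "('b, 'c) monoid_scheme"
  assumes "\<And>u v :: 'x list. u \<noteq> v \<Longrightarrow>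
             \<exists>g \<in> monoid_morphisms free_monoid M. g u \<noteq> g v"
  shows "\<not> (\<exists>u v :: 'x list. u \<noteq> v \<and> satisfies_semigroup_identity M u v)"
    and "\<not> (\<exists>u v :: 'x list. u \<noteq> v \<and> satisfies_monoid_identity M u v)"
proof -
  have "\<not> satisfies_semigroup_identity M u v \<and> \<not> satisfies_monoid_identity M u v"
    if uv: "u \<noteq> v" for u v :: "'x list"
  proof -
    obtain g where "g \<in> monoid_morphisms free_monoid M" and "g u \<noteq> g v"
      using assms[OF uv] by (rule bexE)
    then show ?thesis
      using monoid_morphism_restricts_to_free_semigroup[of g M]
      by (auto simp: satisfies_semigroup_identity_def satisfies_monoid_identity_def)
  qed
  then show "\<not> (\<exists>u v :: 'x list. u \<noteq> v \<and> satisfies_semigroup_identity M u v)"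
    and "\<not> (\<exists>u v :: 'x list. u \<noteq> v \<and> satisfies_monoid_identity M u v)"
    by auto
qed

theorem theorem4p2:
  assumes "\<forall>p q :: 'a::comm_semiring_1 poly.
             p \<noteq> q \<longrightarrow> (\<lambda>x. poly p x) \<noteq> (\<lambda>x. poly q x)"
  shows "\<not> (\<exists>u v :: 'x list. u \<noteq> v \<and>
              satisfies_semigroup_identity (ut_monoid 2 :: 'a mat monoid) u v)
       \<and> \<not> (\<exists>u v :: 'x list. u \<noteq> v \<and>
              satisfies_monoid_identity (ut_monoid 2 :: 'a mat monoid) u v)
       \<and> (\<forall>n \<ge> 2.
              \<not> (\<exists>u v :: 'x list. u \<noteq> v \<and>
                  satisfies_semigroup_identity (ut_monoid n :: 'a mat monoid) u v)
            \<and> \<not> (\<exists>u v :: 'x list. u \<noteq> v \<and>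
                  satisfies_monoid_identity (ut_monoid n :: 'a mat monoid) u v)
            \<and> \<not> (\<exists>u v :: 'x list. u \<noteq> v \<and>
                  satisfies_semigroup_identity (mat_monoid n :: 'a mat monoid) u v)
            \<and> \<not> (\<exists>u v :: 'x list. u \<noteq> v \<and>
                  satisfies_monoid_identity (mat_monoid n :: 'a mat monoid) u v))"
proof -
  have poly_inj: "poly p \<noteq> poly q" if "p \<noteq> q" for p q :: "'a poly"
    using assms that by simp
  have ut: "\<exists>g \<in> monoid_morphisms free_monoid (ut_monoid n :: 'a mat monoid). g u \<noteq> g v"
    if "2 \<le> n" "u \<noteq> v" for n and u v :: "'x list"
    by (intro ut_monoid_separates_words poly_inj that)
  have full: "\<exists>g \<in> monoid_morphisms free_monoid (mat_monoid n :: 'a mat monoid). g u \<noteq> g v"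
    if "2 \<le> n" "u \<noteq> v" for n and u v :: "'x list"
    using ut[OF that] by (auto intro: morphism_ut_monoid_into_mat_monoid)
  show ?thesis
    by (intro conjI allI impI no_identity_if_words_separated ut full) simp_all
qed

end
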